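(* Let $\mathbb{I}=[0,T]$ and consider the coupled differential-algebraic system $$\dot x_{11}=f_1(x_{11},x_{21},z_{11},z_{21}),\quad 0=g_1(x_{11},x_{21},z_{11},z_{21}),\quad \dot x_{21}=f_2(x_{11},x_{21},z_{11},z_{21}),\quad 0=g_2(x_{11},x_{21},z_{11},z_{21})$$ with given initial values for $x=(x_{11},x_{21})\in\mathbb{R}^{n_x}$ and $z=(z_{11},z_{21})\in\mathbb{R}^{n_z}$. Assume that this initial value problem possesses a unique solution $(x,z)$ on $\mathbb{I}$, that $f_i,g_i$, $i\in\{1,2\}$, are sufficiently differentiable in a neighborhood of the solution, and that $\partial(g_1,g_2)/\partial(z_{11},z_{21})$, $\partial g_1/\partial z_{11}$ and $\partial g_2/\partial z_{21}$ are non-singular in a neighborhood of the solution. Let $\varphi$ be the continuously differentiable function with $(z_{11},z_{21})=\varphi(x_{11},x_{21})$ given by the implicit function theorem from $g_1=0$, $g_2=0$, and set $h_i(x_{11},x_{21})=f_i(x_{11},x_{21},\varphi(x_{11},x_{21}))$, $i=1,2$. Assume that a given splitting scheme has convergence order $p$ when applied to the ODE decomposition $$\begin{pmatrix}\dot x_{11} \\ \dot x_{21}\end{pmatrix}=\begin{pmatrix}h_1(x_{11},x_{21}) \\ 0\end{pmatrix}+\begin{pmatrix}0 \\ h_2(x_{11},x_{21})\end{pmatrix}.$$ Then the same splitting scheme, applied to the dimension-reducing DAE decomposition $$\begin{pmatrix}\dot x_{11} \\ 0 \\ \dot x_{21} \\ 0\end{pmatrix}=\begin{pmatrix}f_1 \\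 2g_1 \\ f_2 \\ 2g_2\end{pmatrix}=\begin{pmatrix}f_1 \\ g_1 \\ 0 \\ g_2\end{pmatrix}+\begin{pmatrix}0 \\ g_1 \\ f_2 \\ g_2\end{pmatrix},$$ also has convergence order $p$.
   Context: A splitting scheme for a decomposition into two subproblems is a one-step method obtained by composing the exact flows of the two subproblems over prescribed (scheme-dependent) fractions of the step size $h$. Examples are the Lie-Trotter scheme $\phi_1^{h}\circ\phi_2^{h}$ and the Strang scheme $\phi_2^{h/2}\circ\phi_1^{h}\circ\phi_2^{h/2}$, where $\phi_i^{h}$ is the exact flow of subproblem $i$ over time $h$. The scheme has convergence order $p$ if the error between the numerical approximation and the exact solution on $\mathbb{I}$ is $\mathcal{O}(h^p)$ as $h\to0$. In the DAE decomposition, subproblem 1 is the DAE $\dot x_{11}=f_1$, $0=g_1$, $\dot x_{21}=0$, $0=g_2$ and subproblem 2 is the DAE $\dot x_{11}=0$, $0=g_1$, $\dot x_{21}=f_2$, $0=g_2$; all functions are evaluated at $(x_{11},x_{21},z_{11},z_{21})$. Both algebraic constraints are thus imposed in both subproblems. The exact flow of each subproblem is the flow of its DAE. *)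

theory Defs
  imports "HOL-Analysis.Analysis"
begin

text \<open>Derivatives are taken within \<open>S\<close>, hence one-sided at the endpoints of an interval.\<close>

definition ode_solution ::
    "('x::real_normed_vector \<Rightarrow> 'x) \<Rightarrow> real set \<Rightarrow> (real \<Rightarrow> 'x) \<Rightarrow> bool" where
  "ode_solution F S y \<longleftrightarrow> (\<forall>t\<in>S. (y has_vector_derivative F (y t)) (at t within S))"

text \<open>The semi-explicit DAE \<open>x' = F (x, z)\<close>, \<open>0 = G (x, z)\<close> for the pair \<open>u = (x, z)\<close>. Only the
  differential component is differentiated; the algebraic component is required to be continuous
  (otherwise it could jump between different branches of \<open>G = 0\<close>).\<close>

definition dae_solution ::
    "('x \<times> 'z \<Rightarrow> 'x::real_normed_vector) \<Rightarrow> ('x \<times> 'z \<Rightarrow> 'z::real_normed_vector)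
      \<Rightarrow> real set \<Rightarrow> (real \<Rightarrow> 'x \<times> 'z) \<Rightarrow> bool" where
  "dae_solution F G S u \<longleftrightarrow>
     (\<forall>t\<in>S. ((\<lambda>s. fst (u s)) has_vector_derivative F (u t)) (at t within S) \<and> G (u t) = 0) \<and>
     continuous_on S (\<lambda>s. snd (u s))"

text \<open>Below, \<open>P\<close> is the solution predicate of an autonomous problem: \<open>P S y\<close> says that the curve
  \<open>y\<close> solves the problem on the time set \<open>S\<close>.\<close>

definition unique_solution ::
    "(real set \<Rightarrow> (real \<Rightarrow> 's) \<Rightarrow> bool) \<Rightarrow> real set \<Rightarrow> 's \<Rightarrow> (real \<Rightarrow> 's) \<Rightarrow> bool" where
  "unique_solution P S u0 y \<longleftrightarrow>
     P S y \<and> y 0 = u0 \<and> (\<forall>w. P S w \<and> w 0 = u0 \<longrightarrow> (\<forall>t\<in>S. w t = y t))"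

text \<open>The exact flow over the (possibly negative) time \<open>\<tau>\<close> is a partial map: it is defined at \<open>u\<close>
  iff the initial value problem starting in \<open>u\<close> has a unique solution between times \<open>0\<close> and \<open>\<tau>\<close>.
  In particular, the flow of a DAE is undefined at inconsistent states.\<close>

definition exact_flow ::
    "(real set \<Rightarrow> (real \<Rightarrow> 's) \<Rightarrow> bool) \<Rightarrow> real \<Rightarrow> 's \<Rightarrow> 's option" where
  "exact_flow P \<tau> u =
     (if \<exists>y. unique_solution P (closed_segment 0 \<tau>) u y
      then Some ((SOME y. unique_solution P (closed_segment 0 \<tau>) u y) \<tau>)
      else None)"

lemma exact_flow_eq_Some_iff:
  "exact_flow P \<tau> u = Some v \<longleftrightarrow>
     (\<exists>y. unique_solution P (closed_segment 0 \<tau>) u y \<and> y \<tau> = v)"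
proof -
  have eq: "w \<tau> = y \<tau>"
    if "unique_solution P (closed_segment 0 \<tau>) u y" "unique_solution P (closed_segment 0 \<tau>) u w"
    for y w
    using that unfolding unique_solution_def by blast
  show ?thesis
    unfolding exact_flow_def
    by (smt (verit, best) eq option.distinct(1) option.inject someI_ex)
qed

datatype subproblem = Sub1 | Sub2

text \<open>A scheme lists its stages in the order in which the composition is written, so the last entry
  acts first; \<open>(i, c)\<close> is the exact flow of subproblem \<open>i\<close> over time \<open>c h\<close>. Lie-Trotter is
  \<open>[(Sub1, 1), (Sub2, 1)]\<close>, Strang is \<open>[(Sub2, 1/2), (Sub1, 1), (Sub2, 1/2)]\<close>.\<close>

type_synonym splitting_scheme = "(subproblem \<times> real) list"

definition splitting_step ::
    "splitting_scheme \<Rightarrow> (subproblem \<Rightarrow> real \<Rightarrow> 's \<Rightarrow> 's option) \<Rightarrow> real \<Rightarrow> 's \<Rightarrow> 's option" where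
  "splitting_step s \<Phi> h u =
     foldr (\<lambda>(i, c) v. Option.bind v (\<Phi> i (c * h))) s (Some u)"

primrec splitting_approx ::
    "splitting_scheme \<Rightarrow> (subproblem \<Rightarrow> real \<Rightarrow> 's \<Rightarrow> 's option) \<Rightarrow> real \<Rightarrow> 's \<Rightarrow> nat \<Rightarrow> 's option"
where
  "splitting_approx s \<Phi> h u0 0 = Some u0"
| "splitting_approx s \<Phi> h u0 (Suc n) =
     Option.bind (splitting_approx s \<Phi> h u0 n) (splitting_step s \<Phi> h)"

definition subproblem_flows ::
    "(real set \<Rightarrow> (real \<Rightarrow> 's) \<Rightarrow> bool) \<Rightarrow> (real set \<Rightarrow> (real \<Rightarrow> 's) \<Rightarrow> bool)
      \<Rightarrow> subproblem \<Rightarrow> real \<Rightarrow> 's \<Rightarrow> 's option" where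
  "subproblem_flows P1 P2 i = exact_flow (case i of Sub1 \<Rightarrow> P1 | Sub2 \<Rightarrow> P2)"

text \<open>\<open>P\<close> is the full problem, \<open>P1\<close> and \<open>P2\<close> its two subproblems. The global error over all grid
  points \<open>n h\<close> in \<open>[0, T]\<close> is \<open>O(h^p)\<close> as \<open>h\<close> tends to \<open>0\<close> from the right; this includes that for
  small \<open>h\<close> the scheme is well-defined at all these points.\<close>

definition has_convergence_order ::
    "splitting_scheme \<Rightarrow> nat \<Rightarrow> (real set \<Rightarrow> (real \<Rightarrow> 's) \<Rightarrow> bool) \<Rightarrow> (real set \<Rightarrow> (real \<Rightarrow> 's) \<Rightarrow> bool)
      \<Rightarrow> (real set \<Rightarrow> (real \<Rightarrow> 's) \<Rightarrow> bool) \<Rightarrow> real \<Rightarrow> 's::real_normed_vector \<Rightarrow> bool" where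
  "has_convergence_order s p P P1 P2 T u0 \<longleftrightarrow>
     (\<exists>y. unique_solution P {0..T} u0 y \<and>
       (\<exists>C. \<forall>\<^sub>F h in at_right 0. \<forall>n. real n * h \<le> T \<longrightarrow>
         (\<exists>v. splitting_approx s (subproblem_flows P1 P2) h u0 n = Some v \<and>
              norm (v - y (real n * h)) \<le> C * h ^ p)))"

text \<open>A decomposition is given by the right-hand sides of its two parts, the right-hand side of the
  full problem being their sum. For a DAE this also adds up the constraints.\<close>

definition ode_splitting_order ::
    "splitting_scheme \<Rightarrow> nat \<Rightarrow> ('x \<Rightarrow> 'x) \<Rightarrow> ('x \<Rightarrow> 'x) \<Rightarrow> real \<Rightarrow> 'x::real_normed_vector \<Rightarrow> bool"
where
  "ode_splitting_order s p F1 F2 T x0 \<longleftrightarrow>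
     has_convergence_order s p
       (ode_solution (\<lambda>x. F1 x + F2 x)) (ode_solution F1) (ode_solution F2) T x0"

definition dae_splitting_order ::
    "splitting_scheme \<Rightarrow> nat
      \<Rightarrow> ('x \<times> 'z \<Rightarrow> 'x::real_normed_vector) \<Rightarrow> ('x \<times> 'z \<Rightarrow> 'z::real_normed_vector)
      \<Rightarrow> ('x \<times> 'z \<Rightarrow> 'x) \<Rightarrow> ('x \<times> 'z \<Rightarrow> 'z) \<Rightarrow> real \<Rightarrow> 'x \<times> 'z \<Rightarrow> bool"
where
  "dae_splitting_order s p F1 G1 F2 G2 T u0 \<longleftrightarrow>
     has_convergence_order s p
       (dae_solution (\<lambda>u. F1 u + F2 u) (\<lambda>u. G1 u + G2 u)) (dae_solution F1 G1) (dae_solution F2 G2)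
       T u0"

text \<open>Intended for open \<open>U\<close>, since the derivative is two-sided (unrestricted) at each point.\<close>

definition continuously_differentiable_on ::
    "('a::real_normed_vector \<Rightarrow> 'b::real_normed_vector) \<Rightarrow> 'a set \<Rightarrow> bool" where
  "continuously_differentiable_on f U \<longleftrightarrow>
     (\<exists>f' :: 'a \<Rightarrow> 'a \<Rightarrow>\<^sub>L 'b.
        (\<forall>x\<in>U. (f has_derivative blinfun_apply (f' x)) (at x)) \<and> continuous_on U f')"

end

theory Submission
  imports Defs
begin

text \<open>Along the graph of \<open>\<phi>\<close> the DAE and the ODE describe the same dynamics: since both constraints
  are imposed in both subproblems, a curve \<open>y\<close> solves an ODE subproblem near the solution iff
  \<open>(y, \<phi> \<circ> y)\<close> solves the corresponding DAE subproblem. So the numerical solution of the DAE is the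
  lift \<open>(v, \<phi> v)\<close> of the numerical solution \<open>v\<close> of the ODE, and the error of the lift is at most
  \<open>1 + L\<close> times that of \<open>v\<close>, with \<open>L\<close> a Lipschitz constant of \<open>\<phi>\<close> near the solution.

  The care is needed because the flows are defined by unique solvability among all curves, and
  because nothing is known about the right-hand sides and the constraints away from the solution.
  A competing solution of a DAE subproblem is only continuous in its algebraic component and might
  leave the graph. It cannot: non-singularity of \<open>\<partial>g/\<partial>z\<close> isolates the graph in the set of zeros of the
  constraint (\<open>graph_isolated_in_zero_set\<close>), so by continuity the curve stays on the graph as long
  as its differential component stays near the solution; and on the graph its speed is bounded, so
  for a small step it does stay there. Its differential component then solves the ODE subproblem,
  whose solution is unique because the ODE flow is defined at this point. Hence the existence and
  the uniqueness of the DAE flow are both inherited from the ODE flow (\<open>dae_flow_lifts_ode_flow\<close>).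

  What remains is bookkeeping: for small \<open>h\<close> the convergence of the ODE scheme keeps every grid
  value in a compact tube around the solution, and the stages in between move only \<open>O(h)\<close>;
  the error fits into the tube because \<open>p \<ge> 1\<close>.\<close>

section \<open>Local uniqueness of solutions of the constraint\<close>

lemma continuously_differentiable_on_Pair:
  assumes "continuously_differentiable_on f U" "continuously_differentiable_on g U"
  shows "continuously_differentiable_on (\<lambda>x. (f x, g x)) U"
proof -
  obtain f' g' where f': "\<And>x. x \<in> U \<Longrightarrow> (f has_derivative blinfun_apply (f' x)) (at x)"
      "continuous_on U f'"
    and g': "\<And>x. x \<in> U \<Longrightarrow> (g has_derivative blinfun_apply (g' x)) (at x)" "continuous_on U g'"
    using assms unfolding continuously_differentiable_on_def by metis
  \<comment> \<open>Assembling the derivative from the two injections into the product reduces its continuity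
    in the operator norm to that of composition and addition.\<close>
  define D where "D x = (Blinfun (\<lambda>v. (v, 0)) o\<^sub>L f' x) + (Blinfun (\<lambda>v. (0, v)) o\<^sub>L g' x)" for x
  have "blinfun_apply (D x) = (\<lambda>v. (blinfun_apply (f' x) v, blinfun_apply (g' x) v))" for x
    by (rule ext) (simp add: D_def blinfun.add_left bounded_linear_Blinfun_apply
        bounded_linear_Pair bounded_linear_zero bounded_linear_ident)
  moreover have "continuous_on U D"
    unfolding D_def by (intro continuous_intros f' g')
  ultimately show ?thesis
    unfolding continuously_differentiable_on_def
    by (intro exI[of _ D]) (auto intro!: has_derivative_Pair f' g')
qed

lemma continuously_differentiable_on_imp_continuous_on:
  assumes "continuously_differentiable_on f U"
  shows "continuous_on U f"
  using assms unfolding continuously_differentiable_on_def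
  by (blast intro: continuous_at_imp_continuous_on has_derivative_continuous)

lemma continuously_differentiable_on_imp_locally_injective:
  fixes f :: "'a::euclidean_space \<Rightarrow> 'b::euclidean_space"
  assumes "continuously_differentiable_on f U" "open U" "a \<in> U"
    and "inj (frechet_derivative f (at a))"
  shows "\<exists>r>0. ball a r \<subseteq> U \<and> inj_on f (ball a r)"
proof -
  obtain f' where f': "\<And>x. x \<in> U \<Longrightarrow> (f has_derivative blinfun_apply (f' x)) (at x)"
      "continuous_on U f'"
    using assms unfolding continuously_differentiable_on_def by metis
  have "frechet_derivative f (at a) = blinfun_apply (f' a)"
    by (rule frechet_derivative_at[OF f'(1)[OF assms(3)], symmetric])
  then have "inj (blinfun_apply (f' a))" using assms(4) by simp
  then have "\<exists>k. linear k \<and> k \<circ> blinfun_apply (f' a) = id"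
    by (intro linear_injective_left_inverse bounded_linear.linear blinfun.bounded_linear_right)
  then obtain k where k: "linear k" "k \<circ> blinfun_apply (f' a) = id"
    by (elim exE conjE)
  have cont: "\<exists>d>0. \<forall>x. dist a x < d \<longrightarrow>
          onorm (\<lambda>v. blinfun_apply (f' x) v - blinfun_apply (f' a) v) < e" if "e > 0" for e
  proof -
    have "continuous (at a) f'"
      using f'(2) assms(2,3) continuous_on_eq_continuous_at by blast
    then obtain d where "d > 0" "\<forall>x. dist x a < d \<longrightarrow> dist (f' x) (f' a) < e"
      using \<open>e > 0\<close> unfolding continuous_at_eps_delta by metis
    moreover have "onorm (\<lambda>v. blinfun_apply (f' x) v - blinfun_apply (f' a) v)
        = dist (f' x) (f' a)" for x
      by (simp add: dist_norm norm_blinfun.rep_eq minus_blinfun.rep_eq)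
    ultimately show ?thesis
      by (auto simp: dist_commute[of a])
  qed
  have "bounded_linear k" using k(1) by (simp add: linear_conv_bounded_linear)
  then obtain r where "r > 0" "ball a r \<subseteq> U" "inj_on f (ball a r)"
    by (rule has_derivative_locally_injective[where f = f and f' = "\<lambda>x. blinfun_apply (f' x)"
          and g' = k and a = a and S = U, OF assms(3,2) _ k(2) f'(1) cont])
  then show ?thesis by blast
qed

text \<open>The uniqueness half of the implicit function theorem: if the partial derivative of \<open>g\<close> in the
  second variable is injective, then so is the full derivative of \<open>(a, b) \<mapsto> (a, g (a, b))\<close>, and this
  map is locally injective.\<close>

lemma level_set_locally_graph:
  fixes g :: "'a::euclidean_space \<times> 'b::euclidean_space \<Rightarrow> 'b"
  assumes "continuously_differentiable_on g U" "open U" "(a0, b0) \<in> U"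
    and inj: "inj (frechet_derivative (\<lambda>w. g (a0, w)) (at b0))"
  shows "\<exists>r>0. ball (a0, b0) r \<subseteq> U \<and>
    (\<forall>a b b'. (a, b) \<in> ball (a0, b0) r \<longrightarrow> (a, b') \<in> ball (a0, b0) r \<longrightarrow>
       g (a, b) = g (a, b') \<longrightarrow> b = b')"
proof -
  have "(fst has_derivative blinfun_apply (Blinfun fst)) (at u)" for u :: "'a \<times> 'b"
    by (simp add: bounded_linear_Blinfun_apply bounded_linear_fst bounded_linear_imp_has_derivative)
  then have "continuously_differentiable_on fst U"
    unfolding continuously_differentiable_on_def
    by (intro exI[of _ "\<lambda>_. Blinfun fst"]) simp
  then have cd: "continuously_differentiable_on (\<lambda>u. (fst u, g u)) U"
    using assms(1) by (intro continuously_differentiable_on_Pair)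
  obtain g' where g': "(g has_derivative blinfun_apply g') (at (a0, b0))"
    using assms(1,3) unfolding continuously_differentiable_on_def by blast
  have "((\<lambda>w. g (a0, w)) has_derivative (\<lambda>v. blinfun_apply g' (0, v))) (at b0)"
    by (rule has_derivative_compose[of "\<lambda>w. (a0, w)" "\<lambda>v. (0, v)" b0 UNIV g])
      (use g' in \<open>auto intro!: derivative_eq_intros\<close>)
  from frechet_derivative_at[OF this] inj have inj': "inj (\<lambda>v. blinfun_apply g' (0, v))"
    by simp
  have "((\<lambda>u. (fst u, g u)) has_derivative (\<lambda>v. (fst v, blinfun_apply g' v))) (at (a0, b0))"
    by (intro has_derivative_Pair g' has_derivative_fst has_derivative_ident)
  then have D: "frechet_derivative (\<lambda>u. (fst u, g u)) (at (a0, b0))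
      = (\<lambda>v. (fst v, blinfun_apply g' v))"
    by (rule frechet_derivative_at[symmetric])
  have "inj (\<lambda>v. (fst v, blinfun_apply g' v))"
  proof (rule injI)
    fix v w assume *: "(fst v, blinfun_apply g' v) = (fst w, blinfun_apply g' w)"
    have "(0, snd v - snd w) = v - w" using * by (simp add: prod_eq_iff)
    then have "blinfun_apply g' (0, snd v - snd w) = blinfun_apply g' (0, 0)"
      using * by (simp add: blinfun.diff_right flip: zero_prod_def)
    then have "snd v - snd w = 0" by (rule injD[OF inj'])
    with * show "v = w" by (simp add: prod_eq_iff)
  qed
  then have "inj (frechet_derivative (\<lambda>u. (fst u, g u)) (at (a0, b0)))"
    unfolding D .
  from continuously_differentiable_on_imp_locally_injective[OF cd assms(2,3) this]
  obtain r where r: "r > 0" "ball (a0, b0) r \<subseteq> U"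
      "inj_on (\<lambda>u. (fst u, g u)) (ball (a0, b0) r)"
    by (elim exE conjE)
  show ?thesis
  proof (rule exI[of _ r], intro conjI allI impI)
    show "r > 0" "ball (a0, b0) r \<subseteq> U" by (fact r)+
    fix a b b' assume "(a, b) \<in> ball (a0, b0) r" "(a, b') \<in> ball (a0, b0) r"
      and "g (a, b) = g (a, b')"
    then show "b = b'"
      using inj_onD[OF r(3), of "(a, b)" "(a, b')"] by simp
  qed
qed

text \<open>Near a point of the graph, \<open>b\<close> and \<open>\<phi> a\<close> both solve \<open>g (a, \<cdot>) = 0\<close> close to that point, so they
  agree. One open set \<open>N\<close> around the whole graph, possibly of varying width, is enough for the
  continuity argument about curves that start on the graph.\<close>

lemma graph_isolated_in_zero_set:
  fixes g :: "'a::euclidean_space \<times> 'b::euclidean_space \<Rightarrow> 'b"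
  assumes g: "continuously_differentiable_on g U" "open U"
    and inj: "\<And>a b. (a, b) \<in> U \<Longrightarrow> inj (frechet_derivative (\<lambda>w. g (a, w)) (at b))"
    and V: "open V" "continuous_on V \<phi>" "\<And>a. a \<in> V \<Longrightarrow> (a, \<phi> a) \<in> U \<and> g (a, \<phi> a) = 0"
  shows "\<exists>N. open N \<and> (\<forall>a\<in>V. (a, \<phi> a) \<in> N) \<and> (\<forall>a b. (a, b) \<in> N \<longrightarrow> g (a, b) = 0 \<longrightarrow> b = \<phi> a)"
proof -
  have "\<exists>M. open M \<and> (a0, \<phi> a0) \<in> M \<and> (\<forall>a b. (a, b) \<in> M \<longrightarrow> g (a, b) = 0 \<longrightarrow> b = \<phi> a)"
    if "a0 \<in> V" for a0
  proof -
    have a0: "(a0, \<phi> a0) \<in> U" using V(3) that by blast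
    obtain r where r: "r > 0"
      "\<And>a b b'. (a, b) \<in> ball (a0, \<phi> a0) r \<Longrightarrow> (a, b') \<in> ball (a0, \<phi> a0) r \<Longrightarrow>
         g (a, b) = g (a, b') \<Longrightarrow> b = b'"
      using level_set_locally_graph[OF g a0 inj[OF a0]] by blast
    define W where "W = V \<inter> (\<lambda>a. (a, \<phi> a)) -` ball (a0, \<phi> a0) r"
    have "open W"
      unfolding W_def using V(1,2)
      by (intro continuous_open_preimage continuous_intros) auto
    moreover have "(a0, \<phi> a0) \<in> (W \<times> UNIV) \<inter> ball (a0, \<phi> a0) r"
      using that r(1) by (auto simp: W_def)
    moreover have "b = \<phi> a" if "(a, b) \<in> (W \<times> UNIV) \<inter> ball (a0, \<phi> a0) r" "g (a, b) = 0" for a b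
      using that r(2)[of a b "\<phi> a"] V(3) by (auto simp: W_def)
    ultimately show ?thesis
      by (intro exI[of _ "(W \<times> UNIV) \<inter> ball (a0, \<phi> a0) r"]) (auto intro: open_Times)
  qed
  then obtain M where M: "\<And>a. a \<in> V \<Longrightarrow> open (M a)" "\<And>a. a \<in> V \<Longrightarrow> (a, \<phi> a) \<in> M a"
      "\<And>a0 a b. a0 \<in> V \<Longrightarrow> (a, b) \<in> M a0 \<Longrightarrow> g (a, b) = 0 \<Longrightarrow> b = \<phi> a"
    by metis
  show ?thesis
    by (rule exI[of _ "\<Union>(M ` V)"]) (use M in auto)
qed

section \<open>Transfer of a single exact flow\<close>

text \<open>Otherwise there would be a first time, in absolute value, outside the open set. Segments with
  end point \<open>0\<close> cover the negative times that schemes with negative fractions need.\<close>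

lemma continuous_induction_on_segment:
  fixes w :: "real \<Rightarrow> 'a::topological_space"
  assumes "continuous_on (closed_segment 0 \<tau>) w" "open O'"
    and step: "\<And>t. t \<in> closed_segment 0 \<tau> \<Longrightarrow> w ` (closed_segment 0 t - {t}) \<subseteq> O' \<Longrightarrow> w t \<in> O'"
  shows "w ` closed_segment 0 \<tau> \<subseteq> O'"
proof (rule ccontr)
  define B where "B = closed_segment 0 \<tau> \<inter> w -` (- O')"
  assume "\<not> w ` closed_segment 0 \<tau> \<subseteq> O'"
  then have "B \<noteq> {}" unfolding B_def by blast
  moreover have "closed B"
    unfolding B_def using assms(1,2) by (intro continuous_closed_preimage) auto
  ultimately obtain t where t: "t \<in> B" "\<And>s. s \<in> B \<Longrightarrow> dist 0 t \<le> dist 0 s"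
    using distance_attains_inf by metis
  have "s \<in> closed_segment 0 \<tau> \<and> \<bar>s\<bar> < \<bar>t\<bar>" if "s \<in> closed_segment 0 t - {t}" for s
    using that t(1) unfolding B_def closed_segment_eq_real_ivl by (auto split: if_splits)
  then have "w ` (closed_segment 0 t - {t}) \<subseteq> O'"
    using t(2) unfolding B_def by fastforce
  then show False using step t(1) unfolding B_def by blast
qed

lemma speed_bound_on_segment:
  fixes w :: "real \<Rightarrow> 'a::real_normed_vector"
  assumes "\<And>s. s \<in> closed_segment 0 t \<Longrightarrow> (w has_vector_derivative w' s) (at s within closed_segment 0 t)"
    and "\<And>s. s \<in> closed_segment 0 t \<Longrightarrow> norm (w' s) \<le> M"
  shows "dist (w 0) (w t) \<le> M * \<bar>t\<bar>"
proof -
  have "norm (w t - w 0) \<le> M * norm (t - 0)"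
  proof (rule differentiable_bound)
    show "(w has_derivative (\<lambda>h. h *\<^sub>R w' s)) (at s within closed_segment 0 t)"
      if "s \<in> closed_segment 0 t" for s
      using assms(1)[OF that] by (simp add: has_vector_derivative_def)
    show "onorm (\<lambda>h. h *\<^sub>R w' s) \<le> M" if "s \<in> closed_segment 0 t" for s
      using assms(2)[OF that] 
      by (intro onorm_le) (simp add: mult.commute[of M] mult_left_mono)
  qed auto
  then show ?thesis by (simp add: dist_norm norm_minus_commute)
qed

lemma continuous_image_segment_subset_closed:
  fixes w :: "real \<Rightarrow> 'a::topological_space"
  assumes "continuous_on (closed_segment 0 t) w" "closed C" "t \<noteq> 0"
    and "w ` (closed_segment 0 t - {t}) \<subseteq> C"
  shows "w ` closed_segment 0 t \<subseteq> C"
proof -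
  have "closure (open_segment 0 t) = closed_segment 0 t"
    using assms(3) by simp
  moreover have "w ` open_segment 0 t \<subseteq> C"
    using assms(4) by (auto simp: open_segment_def)
  ultimately show ?thesis
    using image_closure_subset[of "open_segment 0 t" w C] assms(1,2) by simp
qed

text \<open>The situation on a region \<open>D\<close> of differential states in which \<open>\<phi>\<close> solves the constraint \<open>G\<close>: in
  the open set \<open>N\<close> the graph of \<open>\<phi>\<close> contains all consistent states.\<close>

locale isolated_constraint_graph =
  fixes G :: "'x::euclidean_space \<times> 'z::euclidean_space \<Rightarrow> 'z"
    and \<phi> :: "'x \<Rightarrow> 'z" and D :: "'x set" and N :: "('x \<times> 'z) set"
  assumes continuous: "continuous_on D \<phi>"
    and constraint: "a \<in> D \<Longrightarrow> G (a, \<phi> a) = 0"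
    and nhd: "open N" "a \<in> D \<Longrightarrow> (a, \<phi> a) \<in> N"
    and isolated: "(a, b) \<in> N \<Longrightarrow> G (a, b) = 0 \<Longrightarrow> b = \<phi> a"
begin

text \<open>The bound \<open>M * \<bar>\<tau>\<bar> < \<rho>\<close> leaves the time \<open>\<tau>\<close> too short for a curve of speed at most \<open>M\<close> to reach
  the boundary of the ball. This confines the solution of the ODE, so that its lift solves the
  DAE, and it confines every competing solution of the DAE together with the graph. Uniqueness is
  then that of the ODE, which is part of \<open>exact_flow\<close> being defined.\<close>

lemma dae_flow_lifts_ode_flow:
  assumes M: "0 \<le> M" "\<And>a. a \<in> D \<Longrightarrow> norm (F (a, \<phi> a)) \<le> M"
    and \<rho>: "cball \<xi> \<rho> \<subseteq> D" "M * \<bar>\<tau>\<bar> < \<rho>"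
    and flow: "exact_flow (ode_solution (\<lambda>a. F (a, \<phi> a))) \<tau> \<xi> = Some \<eta>"
  shows "exact_flow (dae_solution F G) \<tau> (\<xi>, \<phi> \<xi>) = Some (\<eta>, \<phi> \<eta>)"
    and "dist \<xi> \<eta> \<le> M * \<bar>\<tau>\<bar>"
proof -
  define S where "S = closed_segment 0 \<tau>"
  have sub: "closed_segment 0 t \<subseteq> S" and less: "M * \<bar>t\<bar> < \<rho>" if "t \<in> S" for t
  proof -
    show "closed_segment 0 t \<subseteq> S"
      using that unfolding S_def by (simp add: subset_closed_segment)
    have "\<bar>t\<bar> \<le> \<bar>\<tau>\<bar>"
      using that unfolding S_def closed_segment_eq_real_ivl by (auto split: if_splits)
    then show "M * \<bar>t\<bar> < \<rho>"
      using \<rho>(2) mult_left_mono[OF _ M(1)] by (meson le_less_trans)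
  qed
  have "0 < \<rho>" using \<rho>(2) M(1) by (smt (verit) mult_nonneg_nonneg)
  obtain y where y: "unique_solution (ode_solution (\<lambda>a. F (a, \<phi> a))) S \<xi> y" "y \<tau> = \<eta>"
    using flow unfolding exact_flow_eq_Some_iff S_def by blast
  then have y0: "y 0 = \<xi>"
    and y': "\<And>t. t \<in> S \<Longrightarrow> (y has_vector_derivative F (y t, \<phi> (y t))) (at t within S)"
    and uniq: "\<And>w. ode_solution (\<lambda>a. F (a, \<phi> a)) S w \<Longrightarrow> w 0 = \<xi> \<Longrightarrow> \<forall>t\<in>S. w t = y t"
    unfolding unique_solution_def ode_solution_def by auto
  \<comment> \<open>The curve \<open>u\<close> is the lift of \<open>w\<close> only up to time \<open>t\<close>; this is the induction step both for the
    solution of the ODE and for a competing solution of the DAE.\<close>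
  have stay: "w t \<in> ball \<xi> \<rho> \<and> dist \<xi> (w t) \<le> M * \<bar>t\<bar>"
    if "t \<in> S" "w 0 = \<xi>"
      and w': "\<And>s. s \<in> S \<Longrightarrow> (w has_vector_derivative F (u s)) (at s within S)"
      and u: "\<And>s. s \<in> closed_segment 0 t \<Longrightarrow> w s \<in> cball \<xi> \<rho> \<and> u s = (w s, \<phi> (w s))"
    for w :: "real \<Rightarrow> 'x" and u t
  proof -
    have "dist (w 0) (w t) \<le> M * \<bar>t\<bar>"
    proof (rule speed_bound_on_segment)
      fix s assume s: "s \<in> closed_segment 0 t"
      show "(w has_vector_derivative F (u s)) (at s within closed_segment 0 t)"
        using w' sub[OF \<open>t \<in> S\<close>] s by (meson has_vector_derivative_within_subset subsetD)
      show "norm (F (u s)) \<le> M" using u[OF s] M(2) \<rho>(1) by auto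
    qed
    with \<open>w 0 = \<xi>\<close> less[OF \<open>t \<in> S\<close>] show ?thesis by simp
  qed
  have conty: "continuous_on S y"
    using y' by (meson has_vector_derivative_continuous continuous_on_eq_continuous_within)
  have y_cball: "y ` closed_segment 0 t \<subseteq> cball \<xi> \<rho>"
    if "t \<in> S" "y ` (closed_segment 0 t - {t}) \<subseteq> ball \<xi> \<rho>" for t
  proof (cases "t = 0")
    case False
    then show ?thesis
      using that continuous_on_subset[OF conty sub] ball_subset_cball[of \<xi> \<rho>]
      by (intro continuous_image_segment_subset_closed) auto
  qed (use y0 \<open>0 < \<rho>\<close> in auto)
  have y_ball: "y ` S \<subseteq> ball \<xi> \<rho>"
    unfolding S_def
  proof (rule continuous_induction_on_segment)
    show "continuous_on (closed_segment 0 \<tau>) y" using conty S_def by simp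
    fix t assume "t \<in> closed_segment 0 \<tau>" "y ` (closed_segment 0 t - {t}) \<subseteq> ball \<xi> \<rho>"
    then show "y t \<in> ball \<xi> \<rho>"
      using stay[of t y "\<lambda>s. (y s, \<phi> (y s))"] y_cball y0 y' unfolding S_def by blast
  qed simp
  have "\<tau> \<in> S" by (simp add: S_def)
  show "dist \<xi> \<eta> \<le> M * \<bar>\<tau>\<bar>"
    using stay[of \<tau> y "\<lambda>s. (y s, \<phi> (y s))"] \<open>\<tau> \<in> S\<close> y_ball y0 y' y(2) ball_subset_cball
    unfolding S_def by blast
  have yD: "y t \<in> D" if "t \<in> S" for t
    using that y_ball \<rho>(1) ball_subset_cball by blast
  have "dae_solution F G S (\<lambda>t. (y t, \<phi> (y t)))"
    unfolding dae_solution_def using y' yD constraint conty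
    by (auto intro: continuous_on_compose2[OF continuous])
  moreover have "\<forall>t\<in>S. w t = (y t, \<phi> (y t))"
    if "dae_solution F G S w" "w 0 = (\<xi>, \<phi> \<xi>)" for w
  proof -
    have wx: "\<And>t. t \<in> S \<Longrightarrow> ((\<lambda>s. fst (w s)) has_vector_derivative F (w t)) (at t within S)"
      and G: "\<And>t. t \<in> S \<Longrightarrow> G (w t) = 0" and contz: "continuous_on S (\<lambda>s. snd (w s))"
      using that(1) unfolding dae_solution_def by auto
    have contx: "continuous_on S (\<lambda>s. fst (w s))"
      using wx by (meson has_vector_derivative_continuous continuous_on_eq_continuous_within)
    have contw: "continuous_on S w"
      using continuous_on_Pair[OF contx contz] by simp
    let ?O = "ball \<xi> \<rho> \<times> UNIV \<inter> N"
    have on_graph: "w t = (fst (w t), \<phi> (fst (w t)))" if "t \<in> S" "w t \<in> ?O" for t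
      using isolated[of "fst (w t)" "snd (w t)"] G that by (simp add: prod_eq_iff)
    have w_in: "w ` S \<subseteq> ?O"
      unfolding S_def
    proof (rule continuous_induction_on_segment)
      show "continuous_on (closed_segment 0 \<tau>) w" using contw S_def by simp
      show "open ?O" using nhd(1) by (intro open_Int open_Times) auto
      fix t assume "t \<in> closed_segment 0 \<tau>" and prev: "w ` (closed_segment 0 t - {t}) \<subseteq> ?O"
      then have "t \<in> S" by (simp add: S_def)
      show "w t \<in> ?O"
      proof (cases "t = 0")
        case True
        then show ?thesis using that(2) \<open>0 < \<rho>\<close> nhd(2) \<rho>(1) by (simp add: subset_iff)
      next
        case False
        \<comment> \<open>Lying in the closed ball and on the graph are closed conditions, so they pass from earlier
          times to time \<open>t\<close>. Then the speed bound brings the curve back into the open ball, and the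
          graph lies in the open set \<open>N\<close>.\<close>
        have ball: "(\<lambda>s. fst (w s)) ` closed_segment 0 t \<subseteq> cball \<xi> \<rho>"
          using prev continuous_on_subset[OF contx sub[OF \<open>t \<in> S\<close>]] False
          by (intro continuous_image_segment_subset_closed) auto
        have "(\<lambda>s. snd (w s) - \<phi> (fst (w s))) ` closed_segment 0 t \<subseteq> {0}"
        proof (rule continuous_image_segment_subset_closed)
          show "continuous_on (closed_segment 0 t) (\<lambda>s. snd (w s) - \<phi> (fst (w s)))"
            using continuous_on_subset[OF contx sub[OF \<open>t \<in> S\<close>]]
              continuous_on_subset[OF contz sub[OF \<open>t \<in> S\<close>]] ball \<rho>(1)
            by (intro continuous_on_diff continuous_on_compose2[OF continuous]) auto
          show "(\<lambda>s. snd (w s) - \<phi> (fst (w s))) ` (closed_segment 0 t - {t}) \<subseteq> {0}"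
          proof (rule image_subsetI)
            fix s assume "s \<in> closed_segment 0 t - {t}"
            then have "w s = (fst (w s), \<phi> (fst (w s)))"
              using on_graph[of s] prev sub[OF \<open>t \<in> S\<close>] by blast
            then show "snd (w s) - \<phi> (fst (w s)) \<in> {0}" by (metis diff_self snd_conv singletonI)
          qed
        qed (use False in auto)
        then have graph: "w s = (fst (w s), \<phi> (fst (w s)))" if "s \<in> closed_segment 0 t" for s
          using that by (force simp: prod_eq_iff)
        have "fst (w t) \<in> ball \<xi> \<rho>"
        proof -
          have "fst (w s) \<in> cball \<xi> \<rho>" if "s \<in> closed_segment 0 t" for s
            using ball that by blast
          then show ?thesis
            using stay[of t "\<lambda>s. fst (w s)" w, OF \<open>t \<in> S\<close> _ wx] graph that(2) by simp
        qed
        moreover from this have "w t \<in> N"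
          using nhd(2)[of "fst (w t)"] graph[of t] \<rho>(1) ball_subset_cball[of \<xi> \<rho>]
          by (metis ends_in_segment(2) subsetD)
        ultimately show ?thesis by (simp add: mem_Times_iff)
      qed
    qed
    then have graph: "w t = (fst (w t), \<phi> (fst (w t)))" if "t \<in> S" for t
      using on_graph that by blast
    have "ode_solution (\<lambda>a. F (a, \<phi> a)) S (\<lambda>s. fst (w s))"
      unfolding ode_solution_def using wx graph by metis
    then have "\<forall>t\<in>S. fst (w t) = y t"
      using uniq[of "\<lambda>s. fst (w s)"] that(2) by simp
    then show ?thesis using graph by metis
  qed
  ultimately have "unique_solution (dae_solution F G) S (\<xi>, \<phi> \<xi>) (\<lambda>t. (y t, \<phi> (y t)))"
    unfolding unique_solution_def using y0 by blast
  then show "exact_flow (dae_solution F G) \<tau> (\<xi>, \<phi> \<xi>) = Some (\<eta>, \<phi> \<eta>)"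
    unfolding exact_flow_eq_Some_iff S_def using y(2) by blast
qed

end

section \<open>Transfer of the splitting scheme\<close>

definition total_stage_length :: "splitting_scheme \<Rightarrow> real" where
  "total_stage_length s = (\<Sum>(i, c)\<leftarrow>s. \<bar>c\<bar>)"

lemma total_stage_length_simps [simp]:
  "total_stage_length [] = 0"
  "total_stage_length ((i, c) # s) = \<bar>c\<bar> + total_stage_length s"
  by (simp_all add: total_stage_length_def)

context isolated_constraint_graph
begin

text \<open>The distance estimate is proved along with the lifting because it shows that the later stages
  still start well inside \<open>D\<close>.\<close>

lemma splitting_step_lifts:
  assumes M: "0 \<le> M" "\<And>a. a \<in> D \<Longrightarrow> norm (F1 (a, \<phi> a)) \<le> M" "\<And>a. a \<in> D \<Longrightarrow> norm (F2 (a, \<phi> a)) \<le> M"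
    and "cball \<xi> \<rho> \<subseteq> D" "M * \<bar>h\<bar> * total_stage_length s < \<rho>"
    and "splitting_step s (subproblem_flows (ode_solution (\<lambda>a. F1 (a, \<phi> a)))
           (ode_solution (\<lambda>a. F2 (a, \<phi> a)))) h \<xi> = Some \<eta>"
  shows "splitting_step s (subproblem_flows (dae_solution F1 G) (dae_solution F2 G)) h (\<xi>, \<phi> \<xi>)
      = Some (\<eta>, \<phi> \<eta>) \<and> dist \<xi> \<eta> \<le> M * \<bar>h\<bar> * total_stage_length s"
  using assms(5,6)
proof (induction s arbitrary: \<eta>)
  case Nil
  then show ?case by (simp add: splitting_step_def)
next
  case (Cons st s)
  obtain i c where st: "st = (i, c)" by force
  define F where "F = (case i of Sub1 \<Rightarrow> F1 | Sub2 \<Rightarrow> F2)"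
  have F: "norm (F (a, \<phi> a)) \<le> M" if "a \<in> D" for a
    using M that by (auto simp: F_def split: subproblem.split)
  have flows: "subproblem_flows (ode_solution (\<lambda>a. F1 (a, \<phi> a)))
           (ode_solution (\<lambda>a. F2 (a, \<phi> a))) i = exact_flow (ode_solution (\<lambda>a. F (a, \<phi> a)))"
      "subproblem_flows (dae_solution F1 G) (dae_solution F2 G) i = exact_flow (dae_solution F G)"
    by (simp_all add: subproblem_flows_def F_def split: subproblem.split)
  let ?d = "M * \<bar>h\<bar> * total_stage_length s"
  obtain \<zeta> where \<zeta>: "splitting_step s (subproblem_flows (ode_solution (\<lambda>a. F1 (a, \<phi> a)))
           (ode_solution (\<lambda>a. F2 (a, \<phi> a)))) h \<xi> = Some \<zeta>"
      "exact_flow (ode_solution (\<lambda>a. F (a, \<phi> a))) (c * h) \<zeta> = Some \<eta>"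
    using Cons.prems(2) unfolding st flows(1)[symmetric]
    by (auto simp: splitting_step_def bind_eq_Some_conv)
  have len: "M * \<bar>h\<bar> * total_stage_length (st # s) = ?d + M * \<bar>c * h\<bar>"
    by (simp add: st algebra_simps abs_mult)
  have "0 \<le> M * \<bar>c * h\<bar>" using M(1) by simp
  with Cons.prems(1) len have "?d < \<rho>" by linarith
  then have IH: "splitting_step s (subproblem_flows (dae_solution F1 G) (dae_solution F2 G)) h (\<xi>, \<phi> \<xi>)
      = Some (\<zeta>, \<phi> \<zeta>)" "dist \<xi> \<zeta> \<le> ?d"
    using Cons.IH \<zeta>(1) by blast+
  \<comment> \<open>The ball shrinks by the distance that the stages up to now may have covered.\<close>
  have "cball \<zeta> (\<rho> - ?d) \<subseteq> cball \<xi> \<rho>"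
    using IH(2) by (simp add: cball_subset_cball_iff dist_commute)
  then have "cball \<zeta> (\<rho> - ?d) \<subseteq> D" using assms(4) by blast
  moreover have "M * \<bar>c * h\<bar> < \<rho> - ?d" using Cons.prems(1) len by linarith
  ultimately have "exact_flow (dae_solution F G) (c * h) (\<zeta>, \<phi> \<zeta>) = Some (\<eta>, \<phi> \<eta>)"
      and "dist \<zeta> \<eta> \<le> M * \<bar>c * h\<bar>"
    using dae_flow_lifts_ode_flow[where F = F, OF M(1) F _ _ \<zeta>(2)] by blast+
  then show ?case
    using IH dist_triangle[of \<xi> \<eta> \<zeta>] unfolding len
    by (simp add: st splitting_step_def flows(2))
qed

text \<open>Only the grid values before the last step have to lie well inside \<open>D\<close>, as they are where the steps
  start.\<close>

lemma splitting_approx_lifts: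
  assumes M: "0 \<le> M" "\<And>a. a \<in> D \<Longrightarrow> norm (F1 (a, \<phi> a)) \<le> M" "\<And>a. a \<in> D \<Longrightarrow> norm (F2 (a, \<phi> a)) \<le> M"
    and h: "M * \<bar>h\<bar> * total_stage_length s < \<rho>"
    and near: "\<And>m w. m < n \<Longrightarrow> splitting_approx s (subproblem_flows (ode_solution (\<lambda>a. F1 (a, \<phi> a)))
           (ode_solution (\<lambda>a. F2 (a, \<phi> a)))) h \<xi> m = Some w \<Longrightarrow> cball w \<rho> \<subseteq> D"
    and "splitting_approx s (subproblem_flows (ode_solution (\<lambda>a. F1 (a, \<phi> a)))
           (ode_solution (\<lambda>a. F2 (a, \<phi> a)))) h \<xi> n = Some v"
  shows "splitting_approx s (subproblem_flows (dae_solution F1 G) (dae_solution F2 G)) h (\<xi>, \<phi> \<xi>) n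
      = Some (v, \<phi> v)"
  using near assms(6)
proof (induction n arbitrary: v)
  case (Suc n)
  from Suc.prems(2) obtain w where w: "splitting_approx s (subproblem_flows
        (ode_solution (\<lambda>a. F1 (a, \<phi> a))) (ode_solution (\<lambda>a. F2 (a, \<phi> a)))) h \<xi> n = Some w"
      "splitting_step s (subproblem_flows (ode_solution (\<lambda>a. F1 (a, \<phi> a)))
           (ode_solution (\<lambda>a. F2 (a, \<phi> a)))) h w = Some v"
    by (auto simp: bind_eq_Some_conv)
  have "cball w \<rho> \<subseteq> D" using Suc.prems(1) w(1) by blast
  then have "splitting_step s (subproblem_flows (dae_solution F1 G) (dae_solution F2 G)) h (w, \<phi> w)
      = Some (v, \<phi> v)"
    using splitting_step_lifts[where ?F1.0 = F1 and ?F2.0 = F2, OF M _ h w(2)] by blast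
  moreover have "splitting_approx s (subproblem_flows (dae_solution F1 G) (dae_solution F2 G)) h
      (\<xi>, \<phi> \<xi>) n = Some (w, \<phi> w)"
    using Suc.IH Suc.prems(1) w(1) less_SucI by blast
  ultimately show ?case by simp
qed simp

end

section \<open>Constants on a tube around the solution\<close>

lemma compact_tube_in_open:
  fixes K :: "'a::euclidean_space set"
  assumes "compact K" "open W" "K \<subseteq> W"
  shows "\<exists>R>0. (\<Union>x\<in>K. cball x R) \<subseteq> W \<and> compact (\<Union>x\<in>K. cball x R)"
proof -
  obtain R where R: "R > 0" "(\<Union>x\<in>K. cball x R) \<subseteq> W"
    using compact_subset_open_imp_cball_epsilon_subset[OF assms] by blast
  have "(\<Union>x\<in>K. cball x R) = {x + y | x y. x \<in> K \<and> y \<in> cball 0 R}"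
  proof (intro equalityI subsetI)
    fix a assume "a \<in> (\<Union>x\<in>K. cball x R)"
    then obtain x where "x \<in> K" "a \<in> cball x R" by blast
    then show "a \<in> {x + y | x y. x \<in> K \<and> y \<in> cball 0 R}"
      by (intro CollectI exI[of _ x] exI[of _ "a - x"]) (simp add: dist_norm norm_minus_commute)
  next
    fix a assume "a \<in> {x + y | x y. x \<in> K \<and> y \<in> cball 0 R}"
    then obtain x y where "x \<in> K" "y \<in> cball 0 R" "a = x + y" by blast
    then have "a \<in> cball x R" by (simp add: dist_norm)
    with \<open>x \<in> K\<close> show "a \<in> (\<Union>x\<in>K. cball x R)" by blast
  qed
  then have "compact (\<Union>x\<in>K. cball x R)"
    using compact_sums[OF assms(1) compact_cball[of 0 R]] by (simp only:)
  with R show ?thesis by blast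
qed

text \<open>The tube is not convex in general, but one constant serves all its convex subsets, in particular
  the balls around the points of the solution, and the error is measured inside such a ball.\<close>

lemma continuously_differentiable_on_imp_lipschitz_on_convex:
  fixes f :: "'a::real_normed_vector \<Rightarrow> 'b::real_normed_vector"
  assumes "continuously_differentiable_on f V" "compact D" "D \<subseteq> V"
  shows "\<exists>L\<ge>0. \<forall>C\<subseteq>D. convex C \<longrightarrow> (\<forall>a\<in>C. \<forall>b\<in>C. norm (f a - f b) \<le> L * norm (a - b))"
proof -
  obtain f' where f': "\<And>x. x \<in> V \<Longrightarrow> (f has_derivative blinfun_apply (f' x)) (at x)"
      "continuous_on V f'"
    using assms(1) unfolding continuously_differentiable_on_def by metis
  have "bounded (f' ` D)"
    using compact_continuous_image[OF continuous_on_subset[OF f'(2) assms(3)] assms(2)]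
    by (rule compact_imp_bounded)
  then obtain L where L: "L > 0" "\<And>x. x \<in> D \<Longrightarrow> norm (f' x) \<le> L"
    unfolding bounded_pos by blast
  have "norm (f a - f b) \<le> L * norm (a - b)" if C: "C \<subseteq> D" "convex C" "a \<in> C" "b \<in> C" for C a b
  proof (rule differentiable_bound[OF C(2) _ _ C(3,4)])
    fix x assume "x \<in> C"
    then have "x \<in> D" "x \<in> V" using C(1) assms(3) by auto
    show "(f has_derivative blinfun_apply (f' x)) (at x within C)"
      using f'(1)[OF \<open>x \<in> V\<close>] by (rule has_derivative_at_withinI)
    show "onorm (blinfun_apply (f' x)) \<le> L"
      using L(2)[OF \<open>x \<in> D\<close>] by (simp add: norm_blinfun.rep_eq)
  qed
  then show ?thesis using L(1) by (meson less_imp_le)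
qed

lemma eventually_linear_less:
  assumes "0 < (B::real)"
  shows "\<forall>\<^sub>F h in at_right 0. A * h < B"
proof -
  have "((\<lambda>h. A * h) \<longlongrightarrow> A * 0) (at_right 0)"
    by (intro tendsto_intros)
  then show ?thesis using order_tendstoD(2)[of _ "A * 0"] assms by simp
qed

theorem proposition3p1:
  fixes f1 :: "('x1::euclidean_space \<times> 'x2::euclidean_space) \<times>
                 ('z1::euclidean_space \<times> 'z2::euclidean_space) \<Rightarrow> 'x1"
    and f2 :: "('x1 \<times> 'x2) \<times> ('z1 \<times> 'z2) \<Rightarrow> 'x2"
    and g1 :: "('x1 \<times> 'x2) \<times> ('z1 \<times> 'z2) \<Rightarrow> 'z1"
    and g2 :: "('x1 \<times> 'x2) \<times> ('z1 \<times> 'z2) \<Rightarrow> 'z2"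
    and x0 :: "'x1 \<times> 'x2" and z0 :: "'z1 \<times> 'z2"
    and x :: "real \<Rightarrow> 'x1 \<times> 'x2" and z :: "real \<Rightarrow> 'z1 \<times> 'z2"
    and U :: "(('x1 \<times> 'x2) \<times> ('z1 \<times> 'z2)) set"
    and V :: "('x1 \<times> 'x2) set"
    and \<phi> :: "'x1 \<times> 'x2 \<Rightarrow> 'z1 \<times> 'z2"
    and h1 :: "'x1 \<times> 'x2 \<Rightarrow> 'x1" and h2 :: "'x1 \<times> 'x2 \<Rightarrow> 'x2"
    and T :: real and s :: splitting_scheme and p :: nat
  assumes "0 < T"
    and "unique_solution (dae_solution (\<lambda>u. (f1 u, f2 u)) (\<lambda>u. (g1 u, g2 u)))
           {0..T} (x0, z0) (\<lambda>t. (x t, z t))"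
    and "open U" and "\<forall>t\<in>{0..T}. (x t, z t) \<in> U"
    and "continuously_differentiable_on f1 U" and "continuously_differentiable_on f2 U"
    and "continuously_differentiable_on g1 U" and "continuously_differentiable_on g2 U"
    and "\<forall>(\<xi>, \<zeta>)\<in>U. bij (frechet_derivative (\<lambda>w. (g1 (\<xi>, w), g2 (\<xi>, w))) (at \<zeta>))"
    and "\<forall>(\<xi>, \<zeta>1, \<zeta>2)\<in>U. bij (frechet_derivative (\<lambda>w. g1 (\<xi>, w, \<zeta>2)) (at \<zeta>1))"
    and "\<forall>(\<xi>, \<zeta>1, \<zeta>2)\<in>U. bij (frechet_derivative (\<lambda>w. g2 (\<xi>, \<zeta>1, w)) (at \<zeta>2))"
    and "open V" and "\<forall>t\<in>{0..T}. x t \<in> V"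
    and "continuously_differentiable_on \<phi> V"
    and "\<forall>\<xi>\<in>V. g1 (\<xi>, \<phi> \<xi>) = 0 \<and> g2 (\<xi>, \<phi> \<xi>) = 0"
    and "\<forall>t\<in>{0..T}. z t = \<phi> (x t)"
    and "h1 = (\<lambda>\<xi>. f1 (\<xi>, \<phi> \<xi>))" and "h2 = (\<lambda>\<xi>. f2 (\<xi>, \<phi> \<xi>))"
    and "1 \<le> p"
    and "ode_splitting_order s p (\<lambda>\<xi>. (h1 \<xi>, 0)) (\<lambda>\<xi>. (0, h2 \<xi>)) T x0"
  shows "dae_splitting_order s p
           (\<lambda>u. (f1 u, 0)) (\<lambda>u. (g1 u, g2 u))
           (\<lambda>u. (0, f2 u)) (\<lambda>u. (g1 u, g2 u)) T (x0, z0)"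
proof -
  define F1 :: "('x1 \<times> 'x2) \<times> ('z1 \<times> 'z2) \<Rightarrow> 'x1 \<times> 'x2" where "F1 = (\<lambda>u. (f1 u, 0))"
  define F2 :: "('x1 \<times> 'x2) \<times> ('z1 \<times> 'z2) \<Rightarrow> 'x1 \<times> 'x2" where "F2 = (\<lambda>u. (0, f2 u))"
  define G where "G = (\<lambda>u. (g1 u, g2 u))"
  define O1 where "O1 = ode_solution (\<lambda>a. F1 (a, \<phi> a))"
  define O2 where "O2 = ode_solution (\<lambda>a. F2 (a, \<phi> a))"
  define K where "K = x ` {0..T}"
  define W where "W = V \<inter> (\<lambda>a. (a, \<phi> a)) -` U"
  note U = \<open>open U\<close> and V = \<open>open V\<close>
  have cont\<phi>: "continuous_on V \<phi>"
    by (rule continuously_differentiable_on_imp_continuous_on) fact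
  have G\<phi>: "G (a, \<phi> a) = 0" if "a \<in> V" for a
    using assms(15) that by (simp add: G_def zero_prod_def)
  have sol: "dae_solution (\<lambda>u. (f1 u, f2 u)) G {0..T} (\<lambda>t. (x t, z t))"
      "x0 = x 0" "z0 = z 0"
    using assms(2) unfolding unique_solution_def G_def by auto
  have z: "z t = \<phi> (x t)" if "t \<in> {0..T}" for t using assms(16) that by blast
  have x': "(x has_vector_derivative (f1 (x t, z t), f2 (x t, z t))) (at t within {0..T})"
    if "t \<in> {0..T}" for t
    using sol(1) that unfolding dae_solution_def by auto
  then have contx: "continuous_on {0..T} x"
    by (meson has_vector_derivative_continuous continuous_on_eq_continuous_within)
  \<comment> \<open>\<open>W\<close> also keeps the graph in \<open>U\<close>, where the functions of the DAE are
    continuously differentiable.\<close>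
  have "open W"
    unfolding W_def using U V cont\<phi>
    by (intro continuous_open_preimage continuous_intros) auto
  moreover have "K \<subseteq> W"
    using assms(4,13) z unfolding K_def W_def by auto
  moreover have "compact K"
    unfolding K_def using contx by (intro compact_continuous_image) auto
  ultimately obtain R where R: "R > 0" "(\<Union>x\<in>K. cball x R) \<subseteq> W" "compact (\<Union>x\<in>K. cball x R)"
    using compact_tube_in_open by blast
  define D where "D = (\<Union>x\<in>K. cball x R)"
  have D: "compact D" "D \<subseteq> W" "D \<subseteq> V" using R(2,3) unfolding D_def W_def by auto
  have contD: "continuous_on D \<phi>" using cont\<phi> D(3) continuous_on_subset by blast

  have "continuously_differentiable_on G U"
    unfolding G_def by (intro continuously_differentiable_on_Pair assms)
  moreover have "inj (frechet_derivative (\<lambda>w. G (a, w)) (at b))" if "(a, b) \<in> U" for a b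
    using assms(9) that unfolding G_def by (auto intro: bij_is_inj)
  moreover have "continuous_on W \<phi>"
    by (rule continuous_on_subset[OF cont\<phi>]) (simp add: W_def)
  moreover have "(a, \<phi> a) \<in> U \<and> G (a, \<phi> a) = 0" if "a \<in> W" for a
    using that G\<phi> by (simp add: W_def)
  ultimately have "\<exists>N. open N \<and> (\<forall>a\<in>W. (a, \<phi> a) \<in> N) \<and>
      (\<forall>a b. (a, b) \<in> N \<longrightarrow> G (a, b) = 0 \<longrightarrow> b = \<phi> a)"
    by (intro graph_isolated_in_zero_set[OF _ U _ \<open>open W\<close>])
  then obtain N where N: "open N" "\<And>a. a \<in> W \<Longrightarrow> (a, \<phi> a) \<in> N"
      "\<And>a b. (a, b) \<in> N \<Longrightarrow> G (a, b) = 0 \<Longrightarrow> b = \<phi> a"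
    by (elim exE conjE) blast
  interpret isolated_constraint_graph G \<phi> D N
    by unfold_locales (use contD G\<phi> D N in auto)

  have graphD: "(\<lambda>a. (a, \<phi> a)) ` D \<subseteq> U" using D(2) unfolding W_def by auto
  have "continuous_on U F1" "continuous_on U F2"
    unfolding F1_def F2_def
    by (intro continuous_on_Pair continuous_on_const
        continuously_differentiable_on_imp_continuous_on assms)+
  then have "continuous_on D (\<lambda>a. F1 (a, \<phi> a))" "continuous_on D (\<lambda>a. F2 (a, \<phi> a))"
    using contD graphD by (auto intro!: continuous_on_compose2[of U _ D] continuous_intros)
  then have "bounded ((\<lambda>a. F1 (a, \<phi> a)) ` D)" "bounded ((\<lambda>a. F2 (a, \<phi> a)) ` D)"
    using D(1) by (auto intro!: compact_imp_bounded compact_continuous_image)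
  then have "bounded ((\<lambda>a. F1 (a, \<phi> a)) ` D \<union> (\<lambda>a. F2 (a, \<phi> a)) ` D)" by simp
  then obtain M where "M > 0"
      "\<forall>v \<in> (\<lambda>a. F1 (a, \<phi> a)) ` D \<union> (\<lambda>a. F2 (a, \<phi> a)) ` D. norm v \<le> M"
    unfolding bounded_pos by blast
  then have M: "0 \<le> M" "\<And>a. a \<in> D \<Longrightarrow> norm (F1 (a, \<phi> a)) \<le> M"
      "\<And>a. a \<in> D \<Longrightarrow> norm (F2 (a, \<phi> a)) \<le> M"
    by auto
  from continuously_differentiable_on_imp_lipschitz_on_convex[OF assms(14) D(1,3)]
  obtain L where L: "L \<ge> 0"
      "\<forall>C\<subseteq>D. convex C \<longrightarrow> (\<forall>a\<in>C. \<forall>b\<in>C. norm (\<phi> a - \<phi> b) \<le> L * norm (a - b))"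
    by (elim exE conjE)

  have "has_convergence_order s p
      (ode_solution (\<lambda>a. F1 (a, \<phi> a) + F2 (a, \<phi> a))) O1 O2 T x0"
    using assms(20)
    unfolding ode_splitting_order_def assms(17,18) O1_def O2_def F1_def F2_def .
  then obtain y C where y: "unique_solution (ode_solution (\<lambda>a. F1 (a, \<phi> a) + F2 (a, \<phi> a))) {0..T} x0 y"
    and C: "\<forall>\<^sub>F h in at_right 0. \<forall>n. real n * h \<le> T \<longrightarrow>
         (\<exists>v. splitting_approx s (subproblem_flows O1 O2) h x0 n = Some v \<and>
              norm (v - y (real n * h)) \<le> C * h ^ p)"
    unfolding has_convergence_order_def by (elim exE conjE)
  have "ode_solution (\<lambda>a. F1 (a, \<phi> a) + F2 (a, \<phi> a)) {0..T} x"
    unfolding ode_solution_def using x' z by (auto simp: F1_def F2_def)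
  then have yx: "y t = x t" if "t \<in> {0..T}" for t
    using y sol(2) that unfolding unique_solution_def by auto

  \<comment> \<open>The radius \<open>R\<close> of the tube is shared: one half for the error at the grid points, the other half
    for the motion during the stages of one step.\<close>
  have "\<forall>\<^sub>F h in at_right 0. \<forall>n. real n * h \<le> T \<longrightarrow>
         (\<exists>v. splitting_approx s (subproblem_flows (dae_solution F1 G) (dae_solution F2 G)) h (x0, z0) n
              = Some v \<and> norm (v - (x (real n * h), z (real n * h))) \<le> ((1 + L) * C) * h ^ p)"
    using C eventually_at_right_less[of 0] eventually_linear_less[OF zero_less_one, of 1]
      eventually_linear_less[of "R / 2" "\<bar>C\<bar>", OF half_gt_zero[OF R(1)]]
      eventually_linear_less[of "R / 2" "M * total_stage_length s", OF half_gt_zero[OF R(1)]]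
  proof eventually_elim
    case (elim h)
    \<comment> \<open>Here \<open>p \<ge> 1\<close> enters: it makes the error tend to zero with \<open>h\<close>.\<close>
    have "h ^ p \<le> h" using power_decreasing[of 1 p h] assms(19) elim(2,3) by simp
    then have "C * h ^ p \<le> \<bar>C\<bar> * h"
      using elim(2) by (intro mult_mono) auto
    then have Ch: "C * h ^ p < R / 2" using elim(4) by linarith
    have stages: "M * \<bar>h\<bar> * total_stage_length s < R / 2"
      using elim(2,5) by (simp add: algebra_simps)
    have grid: "real m * h \<in> {0..T}" if "real m * h \<le> T" for m using that elim(2) by simp
    have tube: "cball (x (real m * h)) R \<subseteq> D" if "real m * h \<le> T" for m
      using grid[OF that] unfolding D_def K_def by blast
    show ?case
    proof (intro allI impI)
      fix n assume n: "real n * h \<le> T"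
      then obtain v where v: "splitting_approx s (subproblem_flows O1 O2) h x0 n = Some v"
          "norm (v - x (real n * h)) \<le> C * h ^ p"
        using elim(1) yx[OF grid[OF n]] by metis
      have "cball w (R / 2) \<subseteq> D"
        if "m < n" "splitting_approx s (subproblem_flows O1 O2) h x0 m = Some w" for m w
      proof -
        have m: "real m * h \<le> T"
          using n mult_right_mono[of "real m" "real n" h] that(1) elim(2) by linarith
        then have "norm (w - x (real m * h)) \<le> C * h ^ p"
          using elim(1) yx[OF grid[OF m]] that(2) by (metis option.inject)
        then have "cball w (R / 2) \<subseteq> cball (x (real m * h)) R"
          using Ch by (simp add: cball_subset_cball_iff dist_norm)
        then show ?thesis using tube[OF m] by blast
      qed
      then have "splitting_approx s (subproblem_flows (dae_solution F1 G) (dae_solution F2 G)) h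
          (x0, \<phi> x0) n = Some (v, \<phi> v)"
        using v(1) splitting_approx_lifts[where ?F1.0 = F1 and ?F2.0 = F2 and n = n and \<xi> = x0
            and v = v, OF M stages]
        unfolding O1_def O2_def by blast
      moreover have "z0 = \<phi> x0" using sol(2,3) assms(1) z[of 0] by simp
      moreover have "norm ((v, \<phi> v) - (x (real n * h), z (real n * h))) \<le> (1 + L) * C * h ^ p"
      proof -
        let ?x = "x (real n * h)"
        have "v \<in> cball ?x R" using v(2) Ch R(1) by (simp add: dist_norm norm_minus_commute)
        then have "norm (\<phi> v - \<phi> ?x) \<le> L * norm (v - ?x)"
          using L(2) tube[OF n] R(1) by (metis centre_in_cball convex_cball less_imp_le)
        then have "norm (v - ?x) + norm (\<phi> v - \<phi> ?x) \<le> (1 + L) * norm (v - ?x)"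
          by (simp add: algebra_simps)
        also have "\<dots> \<le> (1 + L) * (C * h ^ p)" using v(2) L(1) by (intro mult_left_mono) auto
        finally show ?thesis
          using norm_Pair_le[of "v - ?x" "\<phi> v - \<phi> ?x"] z[OF grid[OF n]]
          by (simp add: mult.assoc)
      qed
      ultimately show "\<exists>v. splitting_approx s (subproblem_flows (dae_solution F1 G) (dae_solution F2 G))
            h (x0, z0) n = Some v \<and>
          norm (v - (x (real n * h), z (real n * h))) \<le> (1 + L) * C * h ^ p"
        by blast
    qed
  qed
  moreover have "unique_solution (dae_solution (\<lambda>u. F1 u + F2 u) (\<lambda>u. G u + G u)) {0..T} (x0, z0)
      (\<lambda>t. (x t, z t))"
  proof -
    \<comment> \<open>The sum of the two parts imposes \<open>2 g = 0\<close>.\<close>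
    have "G u + G u = 0 \<longleftrightarrow> G u = 0" for u
      by (metis scaleR_2 scaleR_eq_0_iff zero_neq_numeral)
    then have "dae_solution (\<lambda>u. F1 u + F2 u) (\<lambda>u. G u + G u) = dae_solution (\<lambda>u. (f1 u, f2 u)) G"
      unfolding dae_solution_def F1_def F2_def by (intro ext) simp
    then show ?thesis using assms(2) by (simp add: G_def)
  qed
  ultimately have "has_convergence_order s p (dae_solution (\<lambda>u. F1 u + F2 u) (\<lambda>u. G u + G u))
      (dae_solution F1 G) (dae_solution F2 G) T (x0, z0)"
    unfolding has_convergence_order_def by (intro exI conjI)
  then show ?thesis
    unfolding dae_splitting_order_def F1_def F2_def G_def .
qed

end
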